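(* Let $k\in\mathbb{N}$, set $c_k:=1/\binom{2k}{k}$, and let $n\ge 3k^3\binom{2k}{k}$. Let $\mathcal{F}$ be a $k$-uniform MLCIF on $[n]$ which is not canonical, and let $\omega:[n]\to\mathbb{R}_{\ge0}$ be a non-trivial increasing weight function. If $\mathcal{F}$ is typeless, then \[ \omega(\mathcal{F})<\sum_{j\in[k]}\frac{\omega(\langle j\rangle)}{k}. \] Otherwise, \[ \omega(\mathcal{F})<(1-c_k)\,\omega(\langle\iota(\mathcal{F})\rangle)+c_k\sum_{j\in[k]}\frac{\omega(\langle j\rangle)}{k}. \]
   Context: For $G=\{y_1<\dots<y_k\}$, $F=\{x_1<\dots<x_k\}$ in $\binom{[n]}{k}$, write $G\leq_{\mathrm{LC}} F$ if $y_i\le x_i$ for all $i$. A $k$-uniform MLCIF on $[n]$ is a family $\mathcal{F}\subseteq\binom{[n]}{k}$ that is intersecting, closed under $\leq_{\mathrm{LC}}$-smaller sets, and maximal under inclusion among such families. For $i\in[k]$, $\langle i\rangle:=\{F\in\binom{[n]}{k}:|F\cap[2i-1]|\ge i\}$ (the canonical MLCIFs); $\mathcal{F}$ is canonical if $\mathcal{F}=\langle i\rangle$ for some $i$. Let $Z_i:=[i,2i-1]\cup[n-k+i+1,n]$. For $F\in\mathcal{F}$, $\iota(F)$ is the smallest $i\in[k]$ with $F\leq_{\mathrm{LC}}Z_i$. $F\in\mathcal{F}$ is strong if $|F\cap[2k+1,n]|=k-\iota(F)$. All strong sets of $\mathcal{F}$ have the same index; if $\mathcal{F}$ has a strong set,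 its type $\iota(\mathcal{F})$ is this common index, and otherwise $\mathcal{F}$ is typeless. For $\omega:[n]\to\mathbb{R}_{\ge0}$, $\omega(F)=\prod_{x\in F}\omega(x)$ and $\omega(\mathcal{F})=\sum_{F\in\mathcal{F}}\omega(F)$; $\omega$ is non-trivial if some $k$-uniform MLCIF on $[n]$ has positive weight, and increasing if $\omega(i)\le\omega(j)$ for $i\le j$. *)

theory Defs
  imports Complex_Main "HOL-Library.Ramsey"
begin

(* The k-subsets of [n] are "nsets {1..n} k". *)

definition lc_le :: "nat set \<Rightarrow> nat set \<Rightarrow> bool" (infix "\<le>\<^sub>L\<^sub>C" 50) where
  "G \<le>\<^sub>L\<^sub>C F \<longleftrightarrow> list_all2 (\<le>) (sorted_list_of_set G) (sorted_list_of_set F)"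

definition intersecting :: "nat set set \<Rightarrow> bool" where
  "intersecting \<F> \<longleftrightarrow> (\<forall>A\<in>\<F>. \<forall>B\<in>\<F>. A \<inter> B \<noteq> {})"

definition lc_closed :: "nat \<Rightarrow> nat \<Rightarrow> nat set set \<Rightarrow> bool" where
  "lc_closed n k \<F> \<longleftrightarrow> (\<forall>F\<in>\<F>. \<forall>G\<in>nsets {1..n} k. G \<le>\<^sub>L\<^sub>C F \<longrightarrow> G \<in> \<F>)"

definition lcif :: "nat \<Rightarrow> nat \<Rightarrow> nat set set \<Rightarrow> bool" where
  "lcif n k \<F> \<longleftrightarrow> \<F> \<subseteq> nsets {1..n} k \<and> intersecting \<F> \<and> lc_closed n k \<F>"

definition mlcif :: "nat \<Rightarrow> nat \<Rightarrow> nat set set \<Rightarrow> bool" where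
  "mlcif n k \<F> \<longleftrightarrow> lcif n k \<F> \<and> (\<forall>\<G>. lcif n k \<G> \<and> \<F> \<subseteq> \<G> \<longrightarrow> \<G> = \<F>)"

definition canonical_family :: "nat \<Rightarrow> nat \<Rightarrow> nat \<Rightarrow> nat set set" where
  "canonical_family n k i = {F \<in> nsets {1..n} k. card (F \<inter> {1..2 * i - 1}) \<ge> i}"

definition canonical :: "nat \<Rightarrow> nat \<Rightarrow> nat set set \<Rightarrow> bool" where
  "canonical n k \<F> \<longleftrightarrow> (\<exists>i\<in>{1..k}. \<F> = canonical_family n k i)"

definition Zset :: "nat \<Rightarrow> nat \<Rightarrow> nat \<Rightarrow> nat set" where
  "Zset n k i = {i..2 * i - 1} \<union> {n - k + i + 1..n}"

(* Meaningful for members F of an MLCIF, for which an index i as required always exists. *)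
definition set_index :: "nat \<Rightarrow> nat \<Rightarrow> nat set \<Rightarrow> nat" where
  "set_index n k F = (LEAST i. i \<in> {1..k} \<and> F \<le>\<^sub>L\<^sub>C Zset n k i)"

definition strong :: "nat \<Rightarrow> nat \<Rightarrow> nat set set \<Rightarrow> nat set \<Rightarrow> bool" where
  "strong n k \<F> F \<longleftrightarrow> F \<in> \<F> \<and> card (F \<inter> {2 * k + 1..n}) = k - set_index n k F"

definition typeless :: "nat \<Rightarrow> nat \<Rightarrow> nat set set \<Rightarrow> bool" where
  "typeless n k \<F> \<longleftrightarrow> \<not> (\<exists>F. strong n k \<F> F)"

(* The common index of the strong sets; meaningful only for MLCIFs that are not typeless. *)
definition family_type :: "nat \<Rightarrow> nat \<Rightarrow> nat set set \<Rightarrow> nat" where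
  "family_type n k \<F> = (THE i. \<exists>F. strong n k \<F> F \<and> set_index n k F = i)"

definition set_weight :: "(nat \<Rightarrow> real) \<Rightarrow> nat set \<Rightarrow> real" where
  "set_weight \<omega> F = (\<Prod>x\<in>F. \<omega> x)"

definition family_weight :: "(nat \<Rightarrow> real) \<Rightarrow> nat set set \<Rightarrow> real" where
  "family_weight \<omega> \<F> = (\<Sum>F\<in>\<F>. set_weight \<omega> F)"

definition nontrivial_weight :: "nat \<Rightarrow> nat \<Rightarrow> (nat \<Rightarrow> real) \<Rightarrow> bool" where
  "nontrivial_weight n k \<omega> \<longleftrightarrow> (\<exists>\<G>. mlcif n k \<G> \<and> family_weight \<omega> \<G> > 0)"

definition c_const :: "nat \<Rightarrow> real" where
  "c_const k = 1 / real ((2 * k) choose k)"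

end

theory Submission
  imports Defs
begin

text \<open>Write \<open>\<langle>j\<rangle>\<close> for the canonical families. A non-strong member of index \<open>j\<close> is a set of \<open>\<langle>j\<rangle>\<close> with more
  than \<open>j\<close> elements in \<open>[2k]\<close>. As the weight is increasing and \<open>n\<close> is large, swapping such an element
  for one beyond \<open>2k\<close> shows that these sets make up less than a fraction \<open>c\<^sub>k / k\<close> of the weight of
  \<open>\<langle>j\<rangle>\<close>, which settles the typeless case. If the type is \<open>i\<close>, all members outside \<open>\<langle>i\<rangle>\<close> are
  non-strong. At least one such member exists, and by closure it rules out every set meeting \<open>[2k]\<close>
  in exactly \<open>[i, 2i - 1]\<close>. This is the heaviest of the \<open>i\<close>-subsets of \<open>[2i - 1]\<close>, so a fraction of
  at least \<open>c\<^sub>k\<close> of the weight of \<open>\<langle>i\<rangle>\<close> is lost.\<close>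

section \<open>The order in terms of counting functions\<close>

text \<open>The positions with entry at most \<open>m\<close> form an initial segment, and
  \<open>(!)\<close> maps them bijectively onto \<open>F \<inter> {..m}\<close>. Positions start at
  0, hence the strict inequality on the right.\<close>

lemma sorted_list_of_set_nth_le_iff:
  fixes F :: "nat set"
  assumes "finite F" "l < card F"
  shows "sorted_list_of_set F ! l \<le> m \<longleftrightarrow> l < card (F \<inter> {..m})"
proof -
  define xs where "xs = sorted_list_of_set F"
  have len: "length xs = card F" and srt: "sorted xs" and dis: "distinct xs" and st: "set xs = F"
    using assms by (auto simp: xs_def)
  have "F \<inter> {..m} = (!) xs ` {i. i < length xs \<and> xs ! i \<le> m}"
    using st by (auto simp: in_set_conv_nth)
  moreover have "inj_on ((!) xs) {i. i < length xs \<and> xs ! i \<le> m}"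
    using dis by (auto simp: inj_on_def nth_eq_iff_index_eq)
  ultimately have card: "card (F \<inter> {..m}) = card {i. i < length xs \<and> xs ! i \<le> m}"
    by (simp add: card_image)
  show ?thesis
  proof (cases "xs ! l \<le> m")
    case True
    have "{..l} \<subseteq> {i. i < length xs \<and> xs ! i \<le> m}"
    proof
      fix i assume "i \<in> {..l}"
      then have "xs ! i \<le> xs ! l" "i < length xs"
        using srt assms(2) len by (auto intro: sorted_nth_mono)
      then show "i \<in> {i. i < length xs \<and> xs ! i \<le> m}" using True by auto
    qed
    then have "card {..l} \<le> card {i. i < length xs \<and> xs ! i \<le> m}"
      by (intro card_mono) auto
    then show ?thesis using True card by (simp add: xs_def)
  next
    case False
    have "{i. i < length xs \<and> xs ! i \<le> m} \<subseteq> {..<l}"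
    proof
      fix i assume i: "i \<in> {i. i < length xs \<and> xs ! i \<le> m}"
      show "i \<in> {..<l}"
      proof (rule ccontr)
        assume "i \<notin> {..<l}"
        then have "xs ! l \<le> xs ! i" using srt i by (auto intro: sorted_nth_mono)
        then show False using i False by auto
      qed
    qed
    then have "card {i. i < length xs \<and> xs ! i \<le> m} \<le> card {..<l}"
      by (intro card_mono) auto
    then show ?thesis using False card by (simp add: xs_def)
  qed
qed

text \<open>Going down in the order can only move elements to the left, so all initial counts grow.
  This form avoids sorted lists in most later arguments.\<close>

lemma lc_le_iff_card:
  assumes "finite F" "finite G"
  shows "G \<le>\<^sub>L\<^sub>C F \<longleftrightarrow> card G = card F \<and> (\<forall>m. card (F \<inter> {..m}) \<le> card (G \<inter> {..m}))"
proof (intro iffI conjI allI)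
  assume le: "G \<le>\<^sub>L\<^sub>C F"
  then show eq: "card G = card F"
    using assms by (auto simp: lc_le_def dest: list_all2_lengthD)
  fix m
  show "card (F \<inter> {..m}) \<le> card (G \<inter> {..m})"
  proof (cases "card (F \<inter> {..m})")
    case (Suc l)
    then have l: "l < card F"
      using card_mono[of F "F \<inter> {..m}"] assms by auto
    have "sorted_list_of_set F ! l \<le> m"
      using sorted_list_of_set_nth_le_iff[OF assms(1) l] Suc by simp
    moreover have "sorted_list_of_set G ! l \<le> sorted_list_of_set F ! l"
      using le l eq by (auto simp: lc_le_def list_all2_conv_all_nth)
    ultimately show ?thesis
      using sorted_list_of_set_nth_le_iff[OF assms(2), of l m] l eq Suc by simp
  qed simp
next
  assume *: "card G = card F \<and> (\<forall>m. card (F \<inter> {..m}) \<le> card (G \<inter> {..m}))"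
  have "sorted_list_of_set G ! l \<le> sorted_list_of_set F ! l" if l: "l < card F" for l
  proof -
    \<comment> \<open>The useful \<open>m\<close> is the \<open>l\<close>-th element of
      \<open>F\<close> itself.\<close>
    have "l < card (F \<inter> {..sorted_list_of_set F ! l})"
      using sorted_list_of_set_nth_le_iff[OF assms(1) l, of "sorted_list_of_set F ! l"] by blast
    then show ?thesis
      using sorted_list_of_set_nth_le_iff[OF assms(2), of l] l * by (metis order_less_le_trans)
  qed
  then show "G \<le>\<^sub>L\<^sub>C F"
    using * by (simp add: lc_le_def list_all2_conv_all_nth)
qed

lemma nsetsD:
  fixes F :: "nat set"
  assumes "F \<in> nsets {1..n} k"
  shows "finite F" "F \<subseteq> {1..n}" "card F = k"
  using assms by (auto simp: nsets_def)

lemma nsets_Int_atMost: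
  fixes F :: "nat set"
  assumes "F \<in> nsets {1..n} k"
  shows "F \<inter> {..m} = F \<inter> {1..m}"
  using assms by (auto simp: nsets_def)

lemma card_Int_atLeastAtMost_diff_le:
  fixes F :: "nat set"
  shows "card (F \<inter> {1..m}) \<le> card (F \<inter> {1..l}) + (m - l)"
proof -
  have "card (F \<inter> {1..m}) \<le> card ((F \<inter> {1..l}) \<union> {l<..m})"
    by (intro card_mono) auto
  also have "\<dots> \<le> card (F \<inter> {1..l}) + card {l<..m}" by (rule card_Un_le)
  finally show ?thesis by simp
qed

lemma card_Int_atLeastAtMost_mono:
  fixes F :: "nat set"
  assumes "l \<le> m"
  shows "card (F \<inter> {1..l}) \<le> card (F \<inter> {1..m})"
  using assms by (intro card_mono) auto

text \<open>This produces explicit sets below \<open>F\<close>: \<open>f\<close> lists the new set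
  in increasing order from position 0, and \<open>count\<close> says that the \<open>l\<close>-th
  element of \<open>F\<close> is not smaller than \<open>f l\<close>.\<close>

lemma lc_le_enumI:
  assumes mono: "strict_mono_on {..<k} f" and F: "F \<in> nsets {1..n} k"
    and count: "\<And>l. l < k \<Longrightarrow> card (F \<inter> {1..f l - 1}) \<le> l"
    and pos: "\<And>l. l < k \<Longrightarrow> 1 \<le> f l"
  shows "f ` {..<k} \<le>\<^sub>L\<^sub>C F"
proof -
  have "sorted_wrt (<) (map f [0..<k])"
    using mono by (auto simp: sorted_wrt_map sorted_wrt_iff_nth_less strict_mono_on_def)
  then have "sorted_list_of_set (set (map f [0..<k])) = map f [0..<k]"
    by (intro sorted_list_of_set.idem_if_sorted_distinct) (auto simp: strict_sorted_iff)
  then have G: "sorted_list_of_set (f ` {..<k}) = map f [0..<k]"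
    by (simp add: lessThan_atLeast0)
  have "f l \<le> sorted_list_of_set F ! l" if l: "l < k" for l
  proof (rule ccontr)
    assume "\<not> f l \<le> sorted_list_of_set F ! l"
    then have "sorted_list_of_set F ! l \<le> f l - 1" by simp
    then have "l < card (F \<inter> {..f l - 1})"
      using sorted_list_of_set_nth_le_iff[of F l] l nsetsD[OF F] by simp
    then show False using count[OF l] nsets_Int_atMost[OF F] by simp
  qed
  then show ?thesis
    using nsetsD[OF F] by (simp add: lc_le_def G list_all2_conv_all_nth)
qed

lemma enum_in_nsets:
  fixes f :: "nat \<Rightarrow> nat"
  assumes "strict_mono_on {..<k} f" "\<And>l. l < k \<Longrightarrow> 1 \<le> f l \<and> f l \<le> n"
  shows "f ` {..<k} \<in> nsets {1..n} k"
  using card_image[OF strict_mono_on_imp_inj_on[OF assms(1)]] assms(2) by (auto simp: nsets_def)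

section \<open>The sets \<open>Zset\<close> and the canonical families\<close>

lemma Zset_in_nsets:
  assumes "1 \<le> i" "i \<le> k" "k + i \<le> n + 1"
  shows "Zset n k i \<in> nsets {1..n} k"
proof -
  have "card (Zset n k i) = card {i..2 * i - 1} + card {n - k + i + 1..n}"
    unfolding Zset_def using assms by (intro card_Un_disjoint) auto
  then show ?thesis using assms by (auto simp: nsets_def Zset_def)
qed

text \<open>\<open>Zset n k i\<close> consists of the \<open>i\<close> largest elements of
  \<open>[2i - 1]\<close> and the \<open>k - i\<close> largest of \<open>[n]\<close>. Hence its
  counting function is pointwise minimal among \<open>k\<close>-sets with at least \<open>i\<close>
  elements in \<open>[2i - 1]\<close>.\<close>

lemma lc_le_Zset_iff:
  assumes "1 \<le> i" "i \<le> k" "k + i \<le> n + 1" and F: "F \<in> nsets {1..n} k"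
  shows "F \<le>\<^sub>L\<^sub>C Zset n k i \<longleftrightarrow> i \<le> card (F \<inter> {1..2 * i - 1})"
proof -
  note Z = Zset_in_nsets[OF assms(1-3)]
  have iff: "F \<le>\<^sub>L\<^sub>C Zset n k i \<longleftrightarrow>
      (\<forall>m. card (Zset n k i \<inter> {1..m}) \<le> card (F \<inter> {1..m}))"
    using lc_le_iff_card[of "Zset n k i" F] nsetsD[OF F] nsetsD[OF Z]
      nsets_Int_atMost[OF F] nsets_Int_atMost[OF Z] by simp
  show ?thesis
  proof
    assume "F \<le>\<^sub>L\<^sub>C Zset n k i"
    then have "card (Zset n k i \<inter> {1..2 * i - 1}) \<le> card (F \<inter> {1..2 * i - 1})"
      using iff by blast
    moreover have "Zset n k i \<inter> {1..2 * i - 1} = {i..2 * i - 1}"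
      using assms by (auto simp: Zset_def)
    ultimately show "i \<le> card (F \<inter> {1..2 * i - 1})" using assms by simp
  next
    assume i: "i \<le> card (F \<inter> {1..2 * i - 1})"
    have "card (Zset n k i \<inter> {1..m}) \<le> card (F \<inter> {1..m})" for m
    proof -
      consider "m \<le> 2 * i - 1" | "2 * i - 1 \<le> m" "m \<le> n - k + i" | "n - k + i < m" "m \<le> n" | "n < m"
        by linarith
      then show ?thesis
      proof cases
        case 1
        have "Zset n k i \<inter> {1..m} \<subseteq> {i..m}"
          using assms 1 by (auto simp: Zset_def)
        then have "card (Zset n k i \<inter> {1..m}) \<le> card {i..m}"
          by (intro card_mono) auto
        then have "card (Zset n k i \<inter> {1..m}) \<le> m + 1 - i" by simp
        \<comment> \<open>Going from \<open>2 * i - 1\<close> down to \<open>m\<close> drops at most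
          \<open>2 * i - 1 - m\<close> elements, which leaves at least
          \<open>m + 1 - i\<close>.\<close>
        moreover have "i \<le> card (F \<inter> {1..m}) + (2 * i - 1 - m)"
          using i card_Int_atLeastAtMost_diff_le[of F "2 * i - 1" m] by simp
        ultimately show ?thesis using 1 assms(1) by linarith
      next
        case 2
        have "Zset n k i \<inter> {1..m} \<subseteq> {i..2 * i - 1}"
          using assms 2 by (auto simp: Zset_def)
        then have "card (Zset n k i \<inter> {1..m}) \<le> card {i..2 * i - 1}"
          by (intro card_mono) auto
        then show ?thesis
          using i assms card_Int_atLeastAtMost_mono[OF 2(1), of F] by simp
      next
        case 3
        have "Zset n k i \<inter> {1..m} \<subseteq> {i..2 * i - 1} \<union> {n - k + i + 1..m}"
          using assms 3 by (auto simp: Zset_def)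
        then have "card (Zset n k i \<inter> {1..m}) \<le> card ({i..2 * i - 1} \<union> {n - k + i + 1..m})"
          by (intro card_mono) auto
        also have "\<dots> \<le> i + (m - (n - k + i))"
          using card_Un_le[of "{i..2 * i - 1}" "{n - k + i + 1..m}"] assms by simp
        finally have "card (Zset n k i \<inter> {1..m}) \<le> i + (m - (n - k + i))" .
        moreover have "F \<inter> {1..n} = F" using nsetsD[OF F] by auto
        \<comment> \<open>The same descent, now from \<open>n\<close> with all \<open>k\<close>
          elements, leaves at least \<open>k - (n - m)\<close>.\<close>
        then have "k \<le> card (F \<inter> {1..m}) + (n - m)"
          using card_Int_atLeastAtMost_diff_le[of F n m] nsetsD[OF F] by simp
        ultimately show ?thesis using 3 assms by linarith
      next
        case 4
        have "F \<inter> {1..m} = F" "Zset n k i \<inter> {1..m} = Zset n k i"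
          using nsetsD[OF F] nsetsD[OF Z] 4 by auto
        then show ?thesis using nsetsD[OF F] nsetsD[OF Z] by simp
      qed
    qed
    then show "F \<le>\<^sub>L\<^sub>C Zset n k i" using iff by blast
  qed
qed

lemma canonical_family_eq_lc_le_Zset:
  assumes "1 \<le> i" "i \<le> k" "k + i \<le> n + 1"
  shows "canonical_family n k i = {F \<in> nsets {1..n} k. F \<le>\<^sub>L\<^sub>C Zset n k i}"
  using lc_le_Zset_iff[OF assms] by (auto simp: canonical_family_def)

text \<open>Two disjoint members would need \<open>2 * i\<close> elements in
  \<open>[2i - 1]\<close>, and initial counts only grow downwards. By this lemma, an MLCIF contained
  in a canonical family must equal it.\<close>

lemma lcif_canonical_family:
  assumes "1 \<le> i"
  shows "lcif n k (canonical_family n k i)"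
  unfolding lcif_def
proof (intro conjI)
  show "canonical_family n k i \<subseteq> nsets {1..n} k" by (auto simp: canonical_family_def)
  show "intersecting (canonical_family n k i)"
    unfolding intersecting_def
  proof (intro ballI notI)
    fix A B assume A: "A \<in> canonical_family n k i" and B: "B \<in> canonical_family n k i"
      and "A \<inter> B = {}"
    then have "card (A \<inter> {1..2 * i - 1}) + card (B \<inter> {1..2 * i - 1})
        = card ((A \<inter> {1..2 * i - 1}) \<union> (B \<inter> {1..2 * i - 1}))"
      by (intro card_Un_disjoint[symmetric]) auto
    also have "\<dots> \<le> card {1..2 * i - 1}" by (intro card_mono) auto
    also have "\<dots> = 2 * i - 1" by simp
    moreover have "i \<le> card (A \<inter> {1..2 * i - 1})" "i \<le> card (B \<inter> {1..2 * i - 1})"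
      using A B by (auto simp: canonical_family_def)
    ultimately show False using assms by linarith
  qed
  show "lc_closed n k (canonical_family n k i)"
    unfolding lc_closed_def
  proof (intro ballI impI)
    fix F G assume F: "F \<in> canonical_family n k i" and G: "G \<in> nsets {1..n} k" and "G \<le>\<^sub>L\<^sub>C F"
    moreover from F have F': "F \<in> nsets {1..n} k" by (simp add: canonical_family_def)
    ultimately have "card (F \<inter> {1..2 * i - 1}) \<le> card (G \<inter> {1..2 * i - 1})"
      using lc_le_iff_card[of F G] nsetsD[OF G] nsetsD[OF F']
        nsets_Int_atMost[OF G] nsets_Int_atMost[OF F'] by simp
    then show "G \<in> canonical_family n k i"
      using F G by (simp add: canonical_family_def)
  qed
qed

section \<open>Disjoint members, indices and strong sets\<close>

text \<open>Closure puts both enumerated sets into the family, which is intersecting. Structural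
  claims thus reduce to finding two disjoint enumerations below given members.\<close>

lemma lcif_disjoint_enum_False:
  assumes L: "lcif n k \<F>" and F: "F \<in> \<F>" and G: "G \<in> \<F>"
    and f: "strict_mono_on {..<k} f" "\<And>l. l < k \<Longrightarrow> 1 \<le> f l \<and> f l \<le> n"
      "\<And>l. l < k \<Longrightarrow> card (F \<inter> {1..f l - 1}) \<le> l"
    and g: "strict_mono_on {..<k} g" "\<And>l. l < k \<Longrightarrow> 1 \<le> g l \<and> g l \<le> n"
      "\<And>l. l < k \<Longrightarrow> card (G \<inter> {1..g l - 1}) \<le> l"
    and disj: "f ` {..<k} \<inter> g ` {..<k} = {}"
  shows False
proof -
  have sub: "F \<in> nsets {1..n} k" "G \<in> nsets {1..n} k"
    using L F G by (auto simp: lcif_def)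
  have "f ` {..<k} \<in> \<F>" "g ` {..<k} \<in> \<F>"
    using L F G lc_le_enumI[OF f(1) sub(1) f(3)] lc_le_enumI[OF g(1) sub(2) g(3)]
      enum_in_nsets[OF f(1,2)] enum_in_nsets[OF g(1,2)] f(2) g(2)
    by (auto simp: lcif_def lc_closed_def)
  then show False using L disj by (auto simp: lcif_def intersecting_def)
qed

text \<open>If no such \<open>i\<close> existed, both \<open>{1, 3, \<dots>, 2k - 1}\<close> and \<open>{2, 4, \<dots>, 2k}\<close> would be members.\<close>

lemma lcif_mem_canonical_family:
  assumes L: "lcif n k \<F>" and F: "F \<in> \<F>" and n: "2 * k \<le> n"
  shows "\<exists>i\<in>{1..k}. F \<in> canonical_family n k i"
proof (rule ccontr)
  assume "\<not> ?thesis"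
  moreover have "F \<in> nsets {1..n} k" using L F by (auto simp: lcif_def)
  ultimately have small: "card (F \<inter> {1..2 * i - 1}) < i" if "1 \<le> i" "i \<le> k" for i
    using that by (auto simp: canonical_family_def not_le)
  \<comment> \<open>\<open>c1\<close> and \<open>c2\<close> are the counting conditions for the even
    and the odd enumeration, both taken below the same \<open>F\<close>.\<close>
  have c1: "card (F \<inter> {1..2 * l + 1}) \<le> l" if "l < k" for l
    using small[of "l + 1"] that by simp
  have c2: "card (F \<inter> {1..2 * l}) \<le> l" if "l < k" for l
    using c1[OF that] card_Int_atLeastAtMost_mono[of "2 * l" "2 * l + 1" F] by linarith
  show False
  proof (rule lcif_disjoint_enum_False[OF L F F, of "\<lambda>l. 2 * l + 2" "\<lambda>l. 2 * l + 1"])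
    have "2 * a + 2 \<noteq> 2 * b + 1" for a b :: nat by presburger
    then show "(\<lambda>l. 2 * l + 2) ` {..<k} \<inter> (\<lambda>l. 2 * l + 1) ` {..<k} = {}" by auto
  qed (use c1 c2 n in \<open>auto simp: strict_mono_on_def\<close>)
qed

text \<open>Some canonical family contains \<open>F\<close>, so the \<open>LEAST\<close> is
  attained; its minimality gives the strict bounds below the index.\<close>

lemma set_index_properties:
  assumes L: "lcif n k \<F>" and F: "F \<in> \<F>" and n: "2 * k \<le> n"
  shows "1 \<le> set_index n k F" "set_index n k F \<le> k"
    "F \<in> canonical_family n k (set_index n k F)"
    "\<And>l. 1 \<le> l \<Longrightarrow> l < set_index n k F \<Longrightarrow> card (F \<inter> {1..2 * l - 1}) < l"
proof -
  have Fn: "F \<in> nsets {1..n} k" using L F by (auto simp: lcif_def)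
  let ?P = "\<lambda>i. i \<in> {1..k} \<and> F \<le>\<^sub>L\<^sub>C Zset n k i"
  have P: "?P i \<longleftrightarrow> 1 \<le> i \<and> i \<le> k \<and> F \<in> canonical_family n k i" for i
    using canonical_family_eq_lc_le_Zset[of i k n] Fn n by auto
  obtain i where "1 \<le> i" "i \<le> k" "F \<in> canonical_family n k i"
    using lcif_mem_canonical_family[OF L F n] by auto
  then have "?P i" using P by blast
  then have "?P (set_index n k F)"
    unfolding set_index_def by (rule LeastI)
  then show *: "1 \<le> set_index n k F" "set_index n k F \<le> k"
    "F \<in> canonical_family n k (set_index n k F)" using P by blast+
  fix l assume l: "1 \<le> l" "l < set_index n k F"
  then have "\<not> ?P l" unfolding set_index_def using not_less_Least by blast
  then have "F \<notin> canonical_family n k l" using P[of l] l * by auto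
  then show "card (F \<inter> {1..2 * l - 1}) < l" using Fn by (simp add: canonical_family_def)
qed

lemma card_Int_upper:
  fixes F :: "nat set"
  assumes F: "F \<in> nsets {1..n} k"
  shows "card (F \<inter> {m + 1..n}) = k - card (F \<inter> {1..m})"
proof -
  have "F \<inter> {m + 1..n} = F - F \<inter> {1..m}" using nsetsD[OF F] by auto
  then show ?thesis using nsetsD[OF F] by (simp add: card_Diff_subset)
qed

text \<open>A member of index \<open>i\<close> has at least \<open>i\<close> elements in
  \<open>[2i - 1]\<close>, hence in \<open>[2k]\<close>. Being strong means that this lower bound is
  attained on \<open>[2k]\<close>.\<close>

lemma strong_iff:
  assumes L: "lcif n k \<F>" and F: "F \<in> \<F>" and n: "2 * k \<le> n"
  shows "strong n k \<F> F \<longleftrightarrow> card (F \<inter> {1..2 * k}) \<le> set_index n k F"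
proof -
  have Fn: "F \<in> nsets {1..n} k" using L F by (auto simp: lcif_def)
  have "set_index n k F \<le> card (F \<inter> {1..2 * set_index n k F - 1})"
    using set_index_properties(3)[OF assms] by (simp add: canonical_family_def)
  also have "\<dots> \<le> card (F \<inter> {1..2 * k})"
    using set_index_properties(2)[OF assms] by (intro card_Int_atLeastAtMost_mono) linarith
  finally have "set_index n k F \<le> card (F \<inter> {1..2 * k})" .
  moreover have "card (F \<inter> {1..2 * k}) \<le> k"
    using card_mono[of F "F \<inter> {1..2 * k}"] nsetsD[OF Fn] by simp
  ultimately show ?thesis
    using F card_Int_upper[OF Fn, of "2 * k"] by (auto simp: strong_def)
qed

text \<open>For indices \<open>i < j\<close> of two strong sets, \<open>{1, 3, \<dots>, 2j - 3} \<union> {2j, 2j + 2, \<dots>, 2k}\<close> and its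
  complement in \<open>[2k]\<close> lie below the respective strong sets.\<close>

lemma strong_set_index_not_less:
  assumes L: "lcif n k \<F>" and n: "2 * k \<le> n"
    and F: "strong n k \<F> F" and G: "strong n k \<F> G"
  shows "\<not> set_index n k F < set_index n k G"
proof
  define i j where "i = set_index n k F" and "j = set_index n k G"
  assume "set_index n k F < set_index n k G"
  then have ij: "i < j" by (simp add: i_def j_def)
  have mem: "F \<in> \<F>" "G \<in> \<F>" using F G by (auto simp: strong_def)
  note pF = set_index_properties[OF L mem(1) n, folded i_def]
  note pG = set_index_properties[OF L mem(2) n, folded j_def]
  have bF: "card (F \<inter> {1..2 * k}) \<le> i" and bG: "card (G \<inter> {1..2 * k}) \<le> j"
    using strong_iff[OF L mem(1) n] strong_iff[OF L mem(2) n] F G by (simp_all add: i_def j_def)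
  \<comment> \<open>Below the index \<open>h\<close>, minimality bounds the count on
    \<open>[2l - 1]\<close> and one more element is allowed; from \<open>h\<close> on, the bound
    \<open>h\<close> on all of \<open>[2k]\<close> is enough.\<close>
  have even: "card (H \<inter> {1..2 * l}) \<le> l"
    if small: "\<And>l. 1 \<le> l \<Longrightarrow> l < h \<Longrightarrow> card (H \<inter> {1..2 * l - 1}) < l"
      and b: "card (H \<inter> {1..2 * k}) \<le> h" and l: "l < k" for H h l
  proof -
    consider "l = 0" | "1 \<le> l" "l < h" | "h \<le> l" by linarith
    then show ?thesis
    proof cases
      case 2
      then show ?thesis
        using small[of l] card_Int_atLeastAtMost_diff_le[of H "2 * l" "2 * l - 1"] by linarith
    next
      case 3
      then show ?thesis
        using b l card_Int_atLeastAtMost_mono[of "2 * l" "2 * k" H] by linarith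
    qed simp
  qed
  define f where "f l = (if l < j - 1 then 2 * l + 1 else 2 * l + 2)" for l :: nat
  define g where "g l = (if l < j - 1 then 2 * l + 2 else 2 * l + 1)" for l :: nat
  show False
  proof (rule lcif_disjoint_enum_False[OF L mem, of f g])
    show "f ` {..<k} \<inter> g ` {..<k} = {}"
    proof -
      have "f a \<noteq> g b" for a b
        unfolding f_def g_def by (split if_split, split if_split) presburger
      then show ?thesis by auto
    qed
    show "strict_mono_on {..<k} f" "strict_mono_on {..<k} g"
      by (auto simp: strict_mono_on_def f_def g_def)
    show "1 \<le> f l \<and> f l \<le> n" "1 \<le> g l \<and> g l \<le> n" if "l < k" for l
      using that n by (auto simp: f_def g_def)
    show "card (F \<inter> {1..f l - 1}) \<le> l" if l: "l < k" for l
    proof (cases "l < j - 1")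
      case True
      then show ?thesis using even[OF pF(4) bF l] by (simp add: f_def)
    next
      case False
      \<comment> \<open>Here \<open>i < j\<close> enters: \<open>i \<le> j - 1 \<le> l\<close>, so
        the bound on \<open>[2k]\<close> suffices at the even places.\<close>
      then show ?thesis
        using card_Int_atLeastAtMost_mono[of "2 * l + 1" "2 * k" F] bF ij l by (simp add: f_def)
    qed
    show "card (G \<inter> {1..g l - 1}) \<le> l" if l: "l < k" for l
    proof (cases "l < j - 1")
      case True
      then have "card (G \<inter> {1..2 * (l + 1) - 1}) < l + 1" by (intro pG(4)) auto
      then show ?thesis using True by (simp add: g_def)
    next
      case False
      then show ?thesis using even[OF pG(4) bG l] by (simp add: g_def)
    qed
  qed
qed

lemma family_type_eq:
  assumes L: "lcif n k \<F>" and n: "2 * k \<le> n" and F: "strong n k \<F> F"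
  shows "family_type n k \<F> = set_index n k F"
  unfolding family_type_def
proof (rule the_equality)
  show "\<exists>G. strong n k \<F> G \<and> set_index n k G = set_index n k F" using F by blast
  show "i = set_index n k F" if "\<exists>G. strong n k \<F> G \<and> set_index n k G = i" for i
    using that strong_set_index_not_less[OF L n] F by (meson linorder_neqE_nat)
qed

section \<open>Weight of the crowded sets\<close>

text \<open>By \<open>strong_iff\<close>, this contains all non-strong members of index
  \<open>j\<close> of any LCIF. It does not refer to the family, so one weight bound serves all of
  them.\<close>

definition crowded_family :: "nat \<Rightarrow> nat \<Rightarrow> nat \<Rightarrow> nat set set" where
  "crowded_family n k j = {F \<in> canonical_family n k j. j < card (F \<inter> {1..2 * k})}"

lemma finite_canonical_family [simp]: "finite (canonical_family n k j)"
proof (rule finite_subset)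
  show "canonical_family n k j \<subseteq> nsets {1..n} k" by (auto simp: canonical_family_def)
qed (auto simp: finite_imp_finite_nsets)

lemma sum_le_sum_inj:
  fixes f :: "'a \<Rightarrow> real" and g :: "'b \<Rightarrow> real"
  assumes "inj_on \<phi> S" "\<phi> ` S \<subseteq> T" "finite T"
    and "\<And>s. s \<in> S \<Longrightarrow> f s \<le> g (\<phi> s)" and "\<And>t. t \<in> T \<Longrightarrow> 0 \<le> g t"
  shows "sum f S \<le> sum g T"
proof -
  have "sum f S \<le> (\<Sum>s\<in>S. g (\<phi> s))" using assms(4) by (rule sum_mono)
  also have "\<dots> = sum g (\<phi> ` S)" using assms(1) by (simp add: sum.reindex)
  also have "\<dots> \<le> sum g T" using assms by (intro sum_mono2) auto
  finally show ?thesis .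
qed

lemma set_weight_nonneg:
  assumes "\<forall>i\<in>{1..n}. \<omega> i \<ge> 0" "F \<subseteq> {1..n}"
  shows "0 \<le> set_weight \<omega> F"
  unfolding set_weight_def using assms by (intro prod_nonneg) auto

text \<open>Written along the sorted lists, the two products compare factor by factor.\<close>

lemma set_weight_mono_lc_le:
  assumes nonneg: "\<forall>i\<in>{1..n}. \<omega> i \<ge> 0" and mono: "mono_on {1..n} \<omega>"
    and "F \<subseteq> {1..n}" "G \<subseteq> {1..n}" and "G \<le>\<^sub>L\<^sub>C F"
  shows "set_weight \<omega> G \<le> set_weight \<omega> F"
proof -
  have fin: "finite F" "finite G" using assms finite_subset by blast+
  have eq: "set_weight \<omega> H = (\<Prod>l<card H. \<omega> (sorted_list_of_set H ! l))" if "finite H" for H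
  proof -
    have "set_weight \<omega> H = prod \<omega> (set (sorted_list_of_set H))"
      using that by (simp add: set_weight_def)
    also have "\<dots> = prod_list (map \<omega> (sorted_list_of_set H))"
      by (simp add: prod.distinct_set_conv_list)
    also have "\<dots> = (\<Prod>l<card H. \<omega> (sorted_list_of_set H ! l))"
      by (simp add: prod.list_conv_set_nth lessThan_atLeast0)
    finally show ?thesis .
  qed
  have card: "card G = card F" using lc_le_iff_card[OF fin] assms by simp
  have "(\<Prod>l<card F. \<omega> (sorted_list_of_set G ! l)) \<le> (\<Prod>l<card F. \<omega> (sorted_list_of_set F ! l))"
  proof (rule prod_mono)
    fix l assume l: "l \<in> {..<card F}"
    then have "sorted_list_of_set G ! l \<in> G" "sorted_list_of_set F ! l \<in> F"
      using card fin
      by (metis lessThan_iff nth_mem set_sorted_list_of_set length_sorted_list_of_set)+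
    moreover have "sorted_list_of_set G ! l \<le> sorted_list_of_set F ! l"
      using assms(5) l card by (simp add: lc_le_def list_all2_conv_all_nth)
    ultimately show "0 \<le> \<omega> (sorted_list_of_set G ! l) \<and>
        \<omega> (sorted_list_of_set G ! l) \<le> \<omega> (sorted_list_of_set F ! l)"
      using assms mono_onD[OF mono] by blast
  qed
  then show ?thesis using eq fin card by simp
qed

text \<open>Replacing the largest element in \<open>[2k]\<close> of a crowded set by any \<open>y > 2k\<close> outside the set stays
  in \<open>\<langle>j\<rangle>\<close>, does not lower the weight, and hits each member of \<open>\<langle>j\<rangle>\<close> at most \<open>2k \<cdot> k\<close> times.\<close>

lemma crowded_weight_le:
  assumes nonneg: "\<forall>i\<in>{1..n}. \<omega> i \<ge> 0" and mono: "mono_on {1..n} \<omega>"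
    and j: "1 \<le> j" "j \<le> k" and n: "3 * k \<le> n"
  shows "(real n - 3 * real k) * family_weight \<omega> (crowded_family n k j)
    \<le> 2 * real k * real k * family_weight \<omega> (canonical_family n k j)"
proof -
  define N C where "N = crowded_family n k j" and "C = canonical_family n k j"
  have Nn: "F \<in> nsets {1..n} k" if "F \<in> N" for F
    using that by (simp add: N_def crowded_family_def canonical_family_def)
  have Cn: "F \<in> nsets {1..n} k" if "F \<in> C" for F
    using that by (simp add: C_def canonical_family_def)
  have finN: "finite N" and finC: "finite C"
    by (simp_all add: N_def C_def crowded_family_def)
  define x where "x F = Max (F \<inter> {1..2 * k})" for F
  define Y where "Y F = {2 * k + 1..n} - F" for F
  \<comment> \<open>Recording the removed and the inserted element makes the swap injective.\<close>
  define \<phi> where "\<phi> = (\<lambda>(F, y). (insert y (F - {x F}), x F, y))"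
  have x: "x F \<in> F \<inter> {1..2 * k}" "\<And>z. z \<in> F \<inter> {1..2 * k} \<Longrightarrow> z \<le> x F" if "F \<in> N" for F
  proof -
    have "F \<inter> {1..2 * k} \<noteq> {}"
      using that by (auto simp: N_def crowded_family_def)
    then show "x F \<in> F \<inter> {1..2 * k}" unfolding x_def by (intro Max_in) auto
    show "z \<le> x F" if "z \<in> F \<inter> {1..2 * k}" for z
      unfolding x_def using that by (intro Max_ge) auto
  qed
  have swap: "insert y (F - {x F}) \<in> C"
    and swap_weight: "set_weight \<omega> F \<le> set_weight \<omega> (insert y (F - {x F}))"
    if F: "F \<in> N" and y: "y \<in> Y F" for F y
  proof -
    note Fn = nsetsD[OF Nn[OF F]]
    have xF: "x F \<in> F" "1 \<le> x F" "x F \<le> 2 * k" using x(1)[OF F] by auto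
    have y': "y \<notin> F" "2 * k < y" "y \<le> n" using y by (auto simp: Y_def)
    \<comment> \<open>If the largest element in \<open>[2k]\<close> lies in \<open>[2j - 1]\<close>,
      so do all of the more than \<open>j\<close> elements in \<open>[2k]\<close>, and one can be
      spared. Otherwise the removal does not touch \<open>[2j - 1]\<close>.\<close>
    have "j \<le> card ((F - {x F}) \<inter> {1..2 * j - 1})"
    proof (cases "x F \<le> 2 * j - 1")
      case True
      then have "(F - {x F}) \<inter> {1..2 * j - 1} = F \<inter> {1..2 * k} - {x F}"
        using x(2)[OF F] j by (fastforce)
      moreover have "j \<le> card (F \<inter> {1..2 * k}) - 1"
        using F by (auto simp: N_def crowded_family_def)
      ultimately show ?thesis using x(1)[OF F] by simp
    next
      case False
      then have "(F - {x F}) \<inter> {1..2 * j - 1} = F \<inter> {1..2 * j - 1}" by auto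
      then show ?thesis
        using F by (simp add: N_def crowded_family_def canonical_family_def)
    qed
    also have "\<dots> \<le> card (insert y (F - {x F}) \<inter> {1..2 * j - 1})"
      by (intro card_mono) auto
    finally show "insert y (F - {x F}) \<in> C"
      using Fn xF y' by (auto simp: C_def canonical_family_def nsets_def card.insert_remove)
    have "\<omega> (x F) \<le> \<omega> y" using mono_onD[OF mono, of "x F" y] xF y' by simp
    moreover have "0 \<le> prod \<omega> (F - {x F})"
      using Fn nonneg by (intro prod_nonneg) auto
    ultimately have "\<omega> (x F) * prod \<omega> (F - {x F}) \<le> \<omega> y * prod \<omega> (F - {x F})"
      by (rule mult_right_mono)
    then show "set_weight \<omega> F \<le> set_weight \<omega> (insert y (F - {x F}))"
      using Fn xF y' by (simp add: set_weight_def prod.remove)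
  qed
  \<comment> \<open>There are \<open>n - 2 * k\<close> candidates beyond \<open>2 * k\<close>, of
    which \<open>F\<close> blocks at most \<open>k\<close>.\<close>
  have cardY: "real n - 3 * real k \<le> real (card (Y F))" if F: "F \<in> N" for F
  proof -
    have "card {2 * k + 1..n} - card F \<le> card (Y F)"
      unfolding Y_def using nsetsD[OF Nn[OF F]] by (intro diff_card_le_card_Diff)
    then have "n \<le> card (Y F) + 3 * k" using nsetsD[OF Nn[OF F]] n by simp
    then show ?thesis by linarith
  qed
  have "(real n - 3 * real k) * family_weight \<omega> N \<le> (\<Sum>F\<in>N. real (card (Y F)) * set_weight \<omega> F)"
    unfolding family_weight_def sum_distrib_left
    using cardY set_weight_nonneg[OF nonneg] nsetsD[OF Nn]
    by (intro sum_mono mult_right_mono) auto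
  also have "\<dots> = (\<Sum>(F, y)\<in>Sigma N Y. set_weight \<omega> F)"
    using finN by (subst sum.Sigma[symmetric]) (auto simp: Y_def)
  also have "\<dots> \<le> (\<Sum>(F, x, y)\<in>Sigma C (\<lambda>F. {1..2 * k} \<times> F). set_weight \<omega> F)"
  proof (rule sum_le_sum_inj[of \<phi>])
    show "inj_on \<phi> (Sigma N Y)"
    proof (rule inj_onI, clarify)
      fix F y G z
      assume *: "F \<in> N" "y \<in> Y F" "G \<in> N" "z \<in> Y G" "\<phi> (F, y) = \<phi> (G, z)"
      then have eq: "insert y (F - {x F}) = insert y (G - {x F})" "x F = x G" "y = z"
        by (auto simp: \<phi>_def)
      have "F = insert (x F) (insert y (F - {x F}) - {y})"
        using * x(1)[of F] by (auto simp: Y_def)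
      also have "\<dots> = G"
        unfolding eq(1) using * x(1)[of G] eq by (auto simp: Y_def)
      finally show "F = G \<and> y = z" using eq by simp
    qed
    show "\<phi> ` Sigma N Y \<subseteq> Sigma C (\<lambda>F. {1..2 * k} \<times> F)"
      using swap x(1) by (fastforce simp: \<phi>_def)
    show "finite (Sigma C (\<lambda>F. {1..2 * k} \<times> F))"
      using finC nsetsD(1)[OF Cn] by (intro finite_SigmaI) auto
  qed (use swap_weight set_weight_nonneg[OF nonneg] nsetsD[OF Cn] in \<open>auto simp: \<phi>_def\<close>)
  also have "\<dots> = (\<Sum>F\<in>C. \<Sum>(x, y)\<in>{1..2 * k} \<times> F. set_weight \<omega> F)"
    using finC nsetsD(1)[OF Cn] by (subst sum.Sigma) auto
  also have "\<dots> = (\<Sum>F\<in>C. 2 * real k * real k * set_weight \<omega> F)"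
    using nsetsD[OF Cn] by (intro sum.cong) (auto simp: case_prod_unfold card_cartesian_product)
  also have "\<dots> = 2 * real k * real k * family_weight \<omega> C"
    by (simp add: family_weight_def sum_distrib_left)
  finally show ?thesis by (simp add: N_def C_def)
qed

section \<open>The sets lost from the canonical family of the type\<close>

text \<open>The block is the greatest \<open>i\<close>-subset of \<open>[2i - 1]\<close> in the
  order; only the part of the set beyond \<open>2 * k\<close> is free.\<close>

definition heaviest_block_family :: "nat \<Rightarrow> nat \<Rightarrow> nat \<Rightarrow> nat set set" where
  "heaviest_block_family n k i = {F \<in> nsets {1..n} k. F \<inter> {1..2 * k} = {i..2 * i - 1}}"

lemma heaviest_block_family_subset:
  assumes "1 \<le> i" "i \<le> k"
  shows "heaviest_block_family n k i \<subseteq> canonical_family n k i"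
proof
  fix F assume F: "F \<in> heaviest_block_family n k i"
  then have "F \<inter> {1..2 * k} = {i..2 * i - 1}" by (simp add: heaviest_block_family_def)
  moreover have "F \<inter> {1..2 * i - 1} = F \<inter> {1..2 * k} \<inter> {1..2 * i - 1}" using assms by auto
  ultimately have "F \<inter> {1..2 * i - 1} = {i..2 * i - 1}" using assms by auto
  then show "F \<in> canonical_family n k i"
    using F assms by (simp add: heaviest_block_family_def canonical_family_def)
qed

text \<open>An uncrowded set is an \<open>i\<close>-subset of \<open>[2i - 1]\<close> together with
  a tail beyond \<open>2 * k\<close>. Replacing the subset by the heaviest block keeps the tail and
  does not lower the weight; the binomial coefficient counts the subsets forgotten.\<close>

lemma canonical_minus_crowded_weight_le:
  assumes nonneg: "\<forall>i\<in>{1..n}. \<omega> i \<ge> 0" and mono: "mono_on {1..n} \<omega>"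
    and i: "1 \<le> i" "i \<le> k" and n: "2 * k \<le> n"
  shows "family_weight \<omega> (canonical_family n k i - crowded_family n k i)
    \<le> real ((2 * i - 1) choose i) * family_weight \<omega> (heaviest_block_family n k i)"
proof -
  define S M B where "S = canonical_family n k i - crowded_family n k i"
    and "M = heaviest_block_family n k i" and "B = nsets {1..2 * i - 1} i"
  define \<phi> where "\<phi> F = ({i..2 * i - 1} \<union> F \<inter> {2 * k + 1..n}, F \<inter> {1..2 * i - 1})" for F
  have Mn: "F \<in> nsets {1..n} k" if "F \<in> M" for F
    using that by (simp add: M_def heaviest_block_family_def)
  have finM: "finite M"
    unfolding M_def using i by (rule finite_subset[OF heaviest_block_family_subset]) simp
  have finB: "finite B" by (simp add: B_def finite_imp_finite_nsets)
  have S: "F \<in> nsets {1..n} k" "F \<inter> {1..2 * i - 1} \<in> B"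
      "F = F \<inter> {1..2 * i - 1} \<union> F \<inter> {2 * k + 1..n}" if F: "F \<in> S" for F
  proof -
    show Fn: "F \<in> nsets {1..n} k" using F by (simp add: S_def canonical_family_def)
    have ge: "i \<le> card (F \<inter> {1..2 * i - 1})" and le: "card (F \<inter> {1..2 * k}) \<le> i"
      using F by (auto simp: S_def crowded_family_def canonical_family_def)
    have sub: "F \<inter> {1..2 * i - 1} \<subseteq> F \<inter> {1..2 * k}" using i by auto
    \<comment> \<open>At least \<open>i\<close> elements in \<open>[2i - 1]\<close> and at most
      \<open>i\<close> in \<open>[2k]\<close> force the two traces to coincide.\<close>
    then have eq: "F \<inter> {1..2 * i - 1} = F \<inter> {1..2 * k}"
      using ge le by (intro card_seteq) auto
    then show "F \<inter> {1..2 * i - 1} \<in> B"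
      using ge le by (auto simp: B_def nsets_def)
    show "F = F \<inter> {1..2 * i - 1} \<union> F \<inter> {2 * k + 1..n}"
      unfolding eq using nsetsD[OF Fn] by auto
  qed
  have "family_weight \<omega> S \<le> (\<Sum>(F, A)\<in>M \<times> B. set_weight \<omega> F)"
    unfolding family_weight_def
  proof (rule sum_le_sum_inj[of \<phi>])
    show "inj_on \<phi> S"
    proof (rule inj_onI)
      fix F G assume FG: "F \<in> S" "G \<in> S" "\<phi> F = \<phi> G"
      have "F \<inter> {2 * k + 1..n} = fst (\<phi> F) \<inter> {2 * k + 1..n}"
        "G \<inter> {2 * k + 1..n} = fst (\<phi> G) \<inter> {2 * k + 1..n}"
        using i by (auto simp: \<phi>_def)
      moreover have "F \<inter> {1..2 * i - 1} = G \<inter> {1..2 * i - 1}"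
        using FG(3) by (simp add: \<phi>_def)
      ultimately show "F = G" using FG S(3) by metis
    qed
    have img: "{i..2 * i - 1} \<union> F \<inter> {2 * k + 1..n} \<in> M" if F: "F \<in> S" for F
    proof -
      have "card F = card (F \<inter> {1..2 * i - 1}) + card (F \<inter> {2 * k + 1..n})"
        using i by (subst S(3)[OF F], intro card_Un_disjoint) auto
      moreover have "card ({i..2 * i - 1} \<union> F \<inter> {2 * k + 1..n})
          = card {i..2 * i - 1} + card (F \<inter> {2 * k + 1..n})"
        using i by (intro card_Un_disjoint) auto
      ultimately have "card ({i..2 * i - 1} \<union> F \<inter> {2 * k + 1..n}) = k"
        using S(2)[OF F] nsetsD[OF S(1)[OF F]] i by (simp add: B_def nsets_def)
      then show ?thesis
        using i n by (auto simp: M_def heaviest_block_family_def nsets_def)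
    qed
    then show "\<phi> ` S \<subseteq> M \<times> B" using S(2) by (auto simp: \<phi>_def)
    show "finite (M \<times> B)" using finM finB by simp
    show "set_weight \<omega> F \<le> (case \<phi> F of (F, A) \<Rightarrow> set_weight \<omega> F)" if F: "F \<in> S" for F
    proof -
      have split: "set_weight \<omega> (A \<union> F \<inter> {2 * k + 1..n})
          = set_weight \<omega> A * set_weight \<omega> (F \<inter> {2 * k + 1..n})" if "A \<subseteq> {1..2 * i - 1}" for A
        unfolding set_weight_def
      proof (rule prod.union_disjoint)
        show "finite A" using that by (rule finite_subset) simp
        have "x \<le> 2 * k" if "x \<in> A" for x
          using \<open>A \<subseteq> _\<close> that i by fastforce
        then show "A \<inter> (F \<inter> {2 * k + 1..n}) = {}" by fastforce
      qed simp
      \<comment> \<open>For ground set \<open>[2i - 1]\<close> and uniformity \<open>i\<close> the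
        upper interval of \<open>Zset\<close> is empty, so \<open>lc_le_Zset_iff\<close> shows that
        the block dominates every \<open>i\<close>-subset.\<close>
      have "{i..2 * i - 1} = Zset (2 * i - 1) i i" using i by (auto simp: Zset_def)
      then have "F \<inter> {1..2 * i - 1} \<le>\<^sub>L\<^sub>C {i..2 * i - 1}"
        using lc_le_Zset_iff[of i i "2 * i - 1" "F \<inter> {1..2 * i - 1}"] S(2)[OF F] i
        by (simp add: B_def Int_assoc nsets_def)
      then have "set_weight \<omega> (F \<inter> {1..2 * i - 1}) \<le> set_weight \<omega> {i..2 * i - 1}"
        using i n by (intro set_weight_mono_lc_le[OF nonneg mono]) auto
      moreover have "0 \<le> set_weight \<omega> (F \<inter> {2 * k + 1..n})"
        by (rule set_weight_nonneg[OF nonneg]) auto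
      ultimately have "set_weight \<omega> (F \<inter> {1..2 * i - 1}) * set_weight \<omega> (F \<inter> {2 * k + 1..n})
          \<le> set_weight \<omega> {i..2 * i - 1} * set_weight \<omega> (F \<inter> {2 * k + 1..n})"
        by (rule mult_right_mono)
      then have "set_weight \<omega> (F \<inter> {1..2 * i - 1} \<union> F \<inter> {2 * k + 1..n})
          \<le> set_weight \<omega> ({i..2 * i - 1} \<union> F \<inter> {2 * k + 1..n})"
        using i by (subst (1 2) split) auto
      then show ?thesis using S(3)[OF F] by (simp add: \<phi>_def)
    qed
    show "0 \<le> (case t of (F, A) \<Rightarrow> set_weight \<omega> F)" if "t \<in> M \<times> B" for t
      using that set_weight_nonneg[OF nonneg] nsetsD[OF Mn] by auto
  qed
  also have "\<dots> = (\<Sum>F\<in>M. real (card B) * set_weight \<omega> F)"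
    using finM finB by (subst sum.cartesian_product[symmetric]) simp
  also have "\<dots> = real ((2 * i - 1) choose i) * family_weight \<omega> M"
    by (simp add: family_weight_def sum_distrib_left B_def)
  finally show ?thesis by (simp add: S_def M_def)
qed

text \<open>A member outside \<open>\<langle>i\<rangle>\<close> dominates \<open>{1, \<dots>, i - 1} \<union> {2i, \<dots>, k + i}\<close>.\<close>

lemma lcif_disjoint_heaviest_block_family:
  assumes L: "lcif n k \<F>" and i: "1 \<le> i" "i \<le> k" and n: "2 * k \<le> n"
    and F: "F \<in> \<F>" "F \<notin> canonical_family n k i"
  shows "\<F> \<inter> heaviest_block_family n k i = {}"
proof -
  have Fn: "F \<in> nsets {1..n} k" using L F by (auto simp: lcif_def)
  have small: "card (F \<inter> {1..2 * i - 1}) \<le> i - 1"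
    using F(2) Fn i by (simp add: canonical_family_def)
  define f where "f l = (if l < i - 1 then l + 1 else l + i + 1)" for l
  have mono: "strict_mono_on {..<k} f" by (auto simp: strict_mono_on_def f_def)
  have count: "card (F \<inter> {1..f l - 1}) \<le> l" for l
  proof (cases "l < i - 1")
    case True
    then show ?thesis using card_mono[of "{1..l}" "F \<inter> {1..l}"] by (simp add: f_def)
  next
    case False
    then show ?thesis
      using small card_Int_atLeastAtMost_diff_le[of F "l + i" "2 * i - 1"] i by (simp add: f_def)
  qed
  have "f ` {..<k} \<in> \<F>"
    using L F(1) lc_le_enumI[OF mono Fn count] enum_in_nsets[OF mono, of n] n i
    by (auto simp: lcif_def lc_closed_def f_def)
  moreover have "f ` {..<k} \<inter> G = {}" if "G \<in> heaviest_block_family n k i" for G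
  proof -
    \<comment> \<open>The largest value is \<open>k + i \<le> 2 * k\<close>, so the set lies in
      \<open>[2k]\<close> and cannot meet \<open>G\<close> in its tail.\<close>
    have "f l \<in> {1..2 * k} - {i..2 * i - 1}" if "l < k" for l
      using that i by (auto simp: f_def)
    moreover have "G \<inter> {1..2 * k} = {i..2 * i - 1}"
      using that by (simp add: heaviest_block_family_def)
    ultimately show ?thesis by blast
  qed
  ultimately show ?thesis using L unfolding lcif_def intersecting_def by blast
qed

section \<open>Assembling the bounds\<close>

lemma family_weight_mono:
  assumes "\<forall>i\<in>{1..n}. \<omega> i \<ge> 0" "\<G> \<subseteq> nsets {1..n} k" "\<F> \<subseteq> \<G>"
  shows "family_weight \<omega> \<F> \<le> family_weight \<omega> \<G>"
  unfolding family_weight_def using assms(3)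
proof (rule sum_mono2[rotated])
  show "finite \<G>"
    using assms(2) by (rule finite_subset) (simp add: finite_imp_finite_nsets)
  show "0 \<le> set_weight \<omega> F" if "F \<in> \<G> - \<F>" for F
    using that assms(2) by (intro set_weight_nonneg[OF assms(1)]) (auto simp: nsets_def)
qed

text \<open>Members are sorted by index, tagging each set with its index. \<open>K\<close> will be
  the canonical families, for positivity of the total weight, and the crowded families, for the
  non-strong members.\<close>

lemma family_weight_le_sum_by_index:
  assumes L: "lcif n k \<F>" and n: "2 * k \<le> n" and nonneg: "\<forall>i\<in>{1..n}. \<omega> i \<ge> 0"
    and X: "\<X> \<subseteq> \<F>" and K: "\<And>j. K j \<subseteq> canonical_family n k j"
    and mem: "\<And>F. F \<in> \<X> \<Longrightarrow> F \<in> K (set_index n k F)"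
  shows "family_weight \<omega> \<X> \<le> (\<Sum>j=1..k. family_weight \<omega> (K j))"
proof -
  have fin: "finite (K j)" for j using K by (rule finite_subset) simp
  have "family_weight \<omega> \<X> \<le> (\<Sum>(j, F)\<in>Sigma {1..k} K. set_weight \<omega> F)"
    unfolding family_weight_def
  proof (rule sum_le_sum_inj[of "\<lambda>F. (set_index n k F, F)"])
    show "(\<lambda>F. (set_index n k F, F)) ` \<X> \<subseteq> Sigma {1..k} K"
      using X mem set_index_properties(1,2)[OF L _ n] by auto
    show "0 \<le> (case t of (j, F) \<Rightarrow> set_weight \<omega> F)" if "t \<in> Sigma {1..k} K" for t
    proof -
      obtain j F where t: "t = (j, F)" "F \<in> K j" using \<open>t \<in> Sigma {1..k} K\<close> by auto
      then have "F \<subseteq> {1..n}" using K[of j] by (auto simp: canonical_family_def nsets_def)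
      then show ?thesis using set_weight_nonneg[OF nonneg] t by simp
    qed
  qed (use fin in \<open>auto simp: inj_on_def\<close>)
  then show ?thesis
    using fin by (simp add: family_weight_def sum.Sigma)
qed

text \<open>Pascal's rule and symmetry give
  \<open>2 * ((2 * i - 1) choose i) = (2 * i) choose i\<close>. The factor 2 will pay for the
  crowded half of a canonical family.\<close>

lemma double_binomial_odd_le:
  assumes "1 \<le> i" "i \<le> k"
  shows "2 * ((2 * i - 1) choose i) \<le> (2 * k) choose k"
proof -
  obtain l where l: "i = Suc l" using assms by (cases i) auto
  have "(Suc (2 * l)) choose l = (Suc (2 * l)) choose Suc l"
    using binomial_symmetric[of l "Suc (2 * l)"] by simp
  then have "2 * ((2 * i - 1) choose i) = (2 * i) choose i" by (simp add: l)
  also have "\<dots> \<le> (2 * k) choose i" using assms by (intro binomial_right_mono) simp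
  also have "\<dots> \<le> (2 * k) choose k" using assms by (intro binomial_mono) auto
  finally show ?thesis .
qed

theorem theorem3p1:
  fixes k n :: nat and \<F> :: "nat set set" and \<omega> :: "nat \<Rightarrow> real"
  assumes "k \<ge> 1"
    and "n \<ge> 3 * k ^ 3 * ((2 * k) choose k)"
    and "mlcif n k \<F>"
    and "\<not> canonical n k \<F>"
    and "\<forall>i\<in>{1..n}. \<omega> i \<ge> 0"
    and "nontrivial_weight n k \<omega>"
    and "mono_on {1..n} \<omega>"
  shows "(typeless n k \<F> \<longrightarrow>
           family_weight \<omega> \<F> < (\<Sum>j=1..k. family_weight \<omega> (canonical_family n k j) / real k)) \<and>
         (\<not> typeless n k \<F> \<longrightarrow>
           family_weight \<omega> \<F> <
             (1 - c_const k) * family_weight \<omega> (canonical_family n k (family_type n k \<F>))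
             + c_const k * (\<Sum>j=1..k. family_weight \<omega> (canonical_family n k j) / real k))"
proof -
  define C where "C = (2 * k) choose k"
  define W N where "W j = family_weight \<omega> (canonical_family n k j)"
    and "N j = family_weight \<omega> (crowded_family n k j)" for j
  define T where "T = (\<Sum>j=1..k. W j)"
  \<comment> \<open>The ratio of the two factors in \<open>crowded_weight_le\<close>.\<close>
  define \<epsilon> where "\<epsilon> = 2 * real k * real k / (real n - 3 * real k)"
  note nonneg = assms(5) and mono = assms(7)
  have C: "1 \<le> C" by (simp add: C_def Suc_le_eq)
  have "k \<le> k ^ 3 * C" using C self_le_power[of k 3] assms(1) by (simp add: mult_le_mono[of k "k ^ 3" 1 C, simplified])
  then have n3: "3 * k \<le> n" using assms(2) by (simp add: C_def)
  then have n2: "2 * k \<le> n" by simp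
  have L: "lcif n k \<F>" using assms(3) by (simp add: mlcif_def)
  have not_sub: "\<not> \<F> \<subseteq> canonical_family n k i" if "1 \<le> i" "i \<le> k" for i
  proof
    assume "\<F> \<subseteq> canonical_family n k i"
    then have "canonical_family n k i = \<F>"
      using assms(3) lcif_canonical_family[OF that(1)] by (simp add: mlcif_def)
    then show False using assms(4) that by (auto simp: canonical_def)
  qed
  \<comment> \<open>For \<open>k = 1\<close> the only canonical family contains every LCIF, so a
    non-canonical MLCIF is impossible.\<close>
  have k2: "2 \<le> k"
  proof (rule ccontr)
    assume "\<not> 2 \<le> k"
    then have "k = 1" using assms(1) by simp
    then have "\<F> \<subseteq> canonical_family n k 1"
      using lcif_mem_canonical_family[OF L _ n2] by auto
    then show False using not_sub assms(1) by simp
  qed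
  \<comment> \<open>Of \<open>n \<ge> 3 * k ^ 3 * C\<close>, the left side uses
    \<open>2 * k ^ 3 * C\<close>; the remaining \<open>k ^ 3 * C\<close> exceeds
    \<open>3 * k\<close> as \<open>k * C * k > 3\<close>.\<close>
  have big: "2 * real k * real k * (real k * real C) < real n - 3 * real k"
  proof -
    have "3 < real k * real C * real k"
    proof -
      have "2 * 2 \<le> k * C * k" using k2 C by (intro mult_le_mono) (auto intro: order_trans[OF _ mult_le_mono[of k k 1 C]])
      then have "3 < k * C * k" by simp
      then show ?thesis by (metis of_nat_less_iff of_nat_mult of_nat_numeral)
    qed
    then have "real k * 3 < real k * (real k * real C * real k)"
      using k2 by (intro mult_strict_left_mono) auto
    moreover have "real (3 * k ^ 3 * C) \<le> real n" using assms(2) by (simp only: C_def of_nat_le_iff)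
    ultimately show ?thesis by (simp add: power3_eq_cube algebra_simps)
  qed
  have kC: "2 \<le> real k * real C"
    using k2 C mult_mono[of 2 "real k" 1 "real C"] by simp
  have D: "0 < real n - 3 * real k"
    using big by (rule le_less_trans[rotated]) simp
  have eps: "\<epsilon> * (real k * real C) < 1"
    using big D by (simp add: \<epsilon>_def field_simps)
  have eps0: "0 \<le> \<epsilon>" using D by (simp add: \<epsilon>_def)
  have eps_half: "\<epsilon> \<le> 1 / 2"
    using mult_left_mono[OF kC eps0] eps by linarith
  have N: "N j \<le> \<epsilon> * W j" if "1 \<le> j" "j \<le> k" for j
    using crowded_weight_le[OF nonneg mono that n3] D
    by (simp add: \<epsilon>_def N_def W_def field_simps)
  have "(\<Sum>j=1..k. N j) \<le> (\<Sum>j=1..k. \<epsilon> * W j)"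
    using N by (intro sum_mono) auto
  then have sumN: "(\<Sum>j=1..k. N j) \<le> \<epsilon> * T"
    by (simp add: T_def sum_distrib_left)
  \<comment> \<open>Every MLCIF weighs at most \<open>T\<close>, so non-triviality makes
    \<open>T\<close> positive; the strictness of both final bounds rests on this.\<close>
  have T: "0 < T"
  proof -
    obtain \<G> where "mlcif n k \<G>" and pos: "0 < family_weight \<omega> \<G>"
      using assms(6) by (auto simp: nontrivial_weight_def)
    then have "lcif n k \<G>" by (simp add: mlcif_def)
    then have "family_weight \<omega> \<G> \<le> T"
      unfolding T_def W_def
      using set_index_properties(3)[OF _ _ n2]
      by (intro family_weight_le_sum_by_index[OF _ n2 nonneg]) auto
    then show ?thesis using pos by simp
  qed
  have "\<epsilon> < 1 / (real k * real C)" using eps kC by (simp add: field_simps)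
  then have epsT: "\<epsilon> * T < c_const k * (T / real k)"
    using mult_strict_right_mono[OF _ T, of \<epsilon> "1 / (real k * real C)"]
    by (simp add: c_const_def C_def mult.commute)
  have weak: "family_weight \<omega> \<X> \<le> \<epsilon> * T"
    if "\<X> \<subseteq> \<F>" and "\<And>F. F \<in> \<X> \<Longrightarrow> \<not> strong n k \<F> F" for \<X>
  proof -
    have "F \<in> crowded_family n k (set_index n k F)" if "F \<in> \<F>" "\<not> strong n k \<F> F" for F
      using that strong_iff[OF L that(1) n2] set_index_properties(3)[OF L that(1) n2]
      by (simp add: crowded_family_def)
    then have "family_weight \<omega> \<X> \<le> (\<Sum>j=1..k. N j)"
      unfolding N_def using that
      by (intro family_weight_le_sum_by_index[OF L n2 nonneg]) (auto simp: crowded_family_def)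
    then show ?thesis using sumN by simp
  qed
  have sumW: "(\<Sum>j=1..k. family_weight \<omega> (canonical_family n k j) / real k) = T / real k"
    by (simp add: T_def W_def sum_divide_distrib)
  show ?thesis
    unfolding sumW
    unfolding W_def[symmetric]
  proof (intro conjI impI)
    assume "typeless n k \<F>"
    then have "family_weight \<omega> \<F> \<le> \<epsilon> * T" by (intro weak) (auto simp: typeless_def)
    also note epsT
    also have "c_const k * (T / real k) \<le> T / real k"
      using T C by (intro mult_left_le_one_le) (auto simp: c_const_def C_def)
    finally show "family_weight \<omega> \<F> < T / real k" .
  next
    assume "\<not> typeless n k \<F>"
    then obtain E where E: "strong n k \<F> E" by (auto simp: typeless_def)
    define i where "i = family_type n k \<F>"
    have strong_i: "set_index n k F = i" if "strong n k \<F> F" for F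
      using family_type_eq[OF L n2 that] by (simp add: i_def)
    have i: "1 \<le> i" "i \<le> k"
      using set_index_properties(1,2)[OF L _ n2, of E] E strong_i[OF E] by (auto simp: strong_def)
    define M where "M = family_weight \<omega> (heaviest_block_family n k i)"
    have can: "canonical_family n k i \<subseteq> nsets {1..n} k" by (auto simp: canonical_family_def)
    have diff: "family_weight \<omega> (canonical_family n k i - \<G>) = W i - family_weight \<omega> \<G>"
      if "\<G> \<subseteq> canonical_family n k i" for \<G>
      unfolding W_def family_weight_def using that by (intro sum_diff) auto
    have M0: "0 \<le> M"
      unfolding M_def using family_weight_mono[OF nonneg, of "heaviest_block_family n k i" k "{}"]
      by (auto simp: family_weight_def heaviest_block_family_def)
    have W0: "0 \<le> W i"
      unfolding W_def using family_weight_mono[OF nonneg can, of "{}"] by (simp add: family_weight_def)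
    \<comment> \<open>Crowded sets carry at most half of \<open>W i\<close>, so
      \<open>W i / 2\<close> is at most \<open>(2 * i - 1) choose i\<close> times \<open>M\<close>,
      hence at most \<open>C / 2 * M\<close>.\<close>
    have "c_const k * W i \<le> M"
    proof -
      have "W i - N i \<le> real ((2 * i - 1) choose i) * M"
        using canonical_minus_crowded_weight_le[OF nonneg mono i n2]
        by (subst (asm) diff) (auto simp: crowded_family_def N_def M_def)
      moreover have "2 * real ((2 * i - 1) choose i) \<le> real C"
        using double_binomial_odd_le[OF i] unfolding C_def by linarith
      then have "2 * (real ((2 * i - 1) choose i) * M) \<le> real C * M"
        using mult_right_mono[OF _ M0] by (metis mult.assoc)
      moreover have "2 * N i \<le> W i"
        using N[OF i] mult_right_mono[OF eps_half W0] by linarith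
      ultimately have "W i \<le> real C * M" by linarith
      then have "W i / real C \<le> M" using C by (simp add: pos_divide_le_eq mult.commute)
      then show ?thesis by (simp add: c_const_def C_def)
    qed
    moreover have "family_weight \<omega> (\<F> \<inter> canonical_family n k i) \<le> W i - M"
    proof -
      obtain F where "F \<in> \<F>" "F \<notin> canonical_family n k i" using not_sub[OF i] by blast
      then have "\<F> \<inter> heaviest_block_family n k i = {}"
        by (rule lcif_disjoint_heaviest_block_family[OF L i n2])
      then have "family_weight \<omega> (\<F> \<inter> canonical_family n k i)
          \<le> family_weight \<omega> (canonical_family n k i - heaviest_block_family n k i)"
        using can by (intro family_weight_mono[OF nonneg]) auto
      then show ?thesis
        using diff[OF heaviest_block_family_subset[OF i]] by (simp add: M_def)
    qed
    moreover have "family_weight \<omega> (\<F> - canonical_family n k i) \<le> \<epsilon> * T"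
    proof (rule weak)
      fix F assume F: "F \<in> \<F> - canonical_family n k i"
      \<comment> \<open>A strong member has index \<open>i\<close> and so lies in the canonical
        family of \<open>i\<close>.\<close>
      show "\<not> strong n k \<F> F"
        using strong_i[of F] set_index_properties(3)[OF L _ n2, of F] F by auto
    qed auto
    moreover have "family_weight \<omega> \<F> = family_weight \<omega> (\<F> \<inter> canonical_family n k i)
        + family_weight \<omega> (\<F> - canonical_family n k i)"
    proof -
      have "finite \<F>"
        using L unfolding lcif_def by (meson finite_subset finite_imp_finite_nsets finite_atLeastAtMost)
      then show ?thesis unfolding family_weight_def by (rule sum.Int_Diff)
    qed
    ultimately have "family_weight \<omega> \<F> < W i - c_const k * W i + c_const k * (T / real k)"
      using epsT by linarith
    then show "family_weight \<omega> \<F> < (1 - c_const k) * W (family_type n k \<F>) + c_const k * (T / real k)"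
      by (simp add: i_def algebra_simps)
  qed
qed

end
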